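(* Let $\phi:\mathbb R\to\mathbb R$ be tanh-like, let $\sigma_w\ge 0$, $\sigma_b>0$, $p^{(0)}\ge 0$, and let $(p^{(l)})_{l\ge 0},(q^{(l)})_{l\ge 1}$ be the length quantities of the reduced residual network (RRN) with nonlinearity $\phi$. (1) If $\sigma_w=0$, then $p^{(l)}=l\,\mathrm V\phi(\sigma_b^2)+p^{(0)}$ and $q^{(l)}=\sigma_b^2$ for all $l\ge1$. (2) If $\sigma_w>0$, then $\lim_{l\to\infty}p^{(l)}/l=1$ and $\lim_{l\to\infty}q^{(l)}/(\sigma_w^2 l)=1$. If moreover $\phi=\tanh$, then, with $C=\sqrt{2/\pi}$, as $l\to\infty$, $$p^{(l)}=l-2C\sigma_w^{-1}l^{1/2}-C^2\sigma_w^{-2}\log l+O(1),\qquad q^{(l)}=\sigma_w^2 l-2C\sigma_w l^{1/2}-C^2\log l+O(1).$$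
   Context: A function $\phi$ is tanh-like if $\phi(-x)=-\phi(x)$, $|\phi(x)|\le 1$ for all $x$, $\phi(x)\ge 0$ for all $x\ge0$, and $\phi(x)$ monotonically increases to $1$ as $x\to\infty$. For $q\ge0$ put $\mathrm V\phi(q)=\mathbb E[\phi(z)^2]$, $z\sim\mathcal N(0,q)$. An RRN has layers $x^{(l)}_i=\phi(h^{(l)}_i)+x^{(l-1)}_i$, $h^{(l)}_i=\sum_j w^{(l)}_{ij}x^{(l-1)}_j+b^{(l)}_i$ with $w^{(l)}_{ij}\sim\mathcal N(0,\sigma_w^2/N)$, $b^{(l)}_i\sim\mathcal N(0,\sigma_b^2)$ i.i.d. Its mean-field (width $N\to\infty$) length quantities $p^{(l)}=\langle (x^{(l)}_1)^2\rangle$, $q^{(l)}=\langle (h_1^{(l)})^2\rangle$ are the deterministic sequences determined, for antisymmetric $\phi$, by $p^{(0)}$ and, for $l\ge1$, $$q^{(l)}=\sigma_w^2p^{(l-1)}+\sigma_b^2,\qquad p^{(l)}=\mathrm V\phi(q^{(l)})+p^{(l-1)}.$$ *)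

theory Defs
  imports "HOL-Probability.Probability" "HOL-Library.Landau_Symbols"
begin

definition tanh_like :: "(real \<Rightarrow> real) \<Rightarrow> bool" where
  "tanh_like \<phi> \<longleftrightarrow>
     (\<forall>x. \<phi> (- x) = - \<phi> x) \<and>
     (\<forall>x. \<bar>\<phi> x\<bar> \<le> 1) \<and>
     (\<forall>x\<ge>0. \<phi> x \<ge> 0) \<and>
     mono \<phi> \<and> (\<phi> \<longlongrightarrow> 1) at_top"

(* The second argument of normal_density is the standard deviation, whereas q is the
   variance; normal_density degenerates to 0 at standard deviation 0, so the point mass
   N(0,0) has to be given separately. *)
definition centered_gaussian :: "real \<Rightarrow> real measure" where
  "centered_gaussian q =
     (if q = 0 then return borel 0 else density lborel (normal_density 0 (sqrt q)))"

definition V_transform :: "(real \<Rightarrow> real) \<Rightarrow> real \<Rightarrow> real" where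
  "V_transform \<phi> q = (LINT z|centered_gaussian q. (\<phi> z)\<^sup>2)"

(* Mean-field recursion of a reduced residual network with antisymmetric nonlinearity.
   The sequence q starts at layer 1; the value q 0 is left unconstrained. *)
definition RRN_length_quantities ::
  "(real \<Rightarrow> real) \<Rightarrow> real \<Rightarrow> real \<Rightarrow> (nat \<Rightarrow> real) \<Rightarrow> (nat \<Rightarrow> real) \<Rightarrow> bool" where
  "RRN_length_quantities \<phi> \<sigma>w \<sigma>b p q \<longleftrightarrow>
     (\<forall>l\<ge>1. q l = \<sigma>w\<^sup>2 * p (l - 1) + \<sigma>b\<^sup>2 \<and>
             p l = V_transform \<phi> (q l) + p (l - 1))"

end

(* The mass of N(0,q) escapes to infinity as q grows, so V_transform \<phi> q \<rightarrow> 1, whence the linear growth.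
   For tanh, the integral of sech^2 gives
   V_transform tanh q = 1 - C / sqrt q + O(q powr (-3/2)), so the recursion
   q (l + 1) = q l + \<sigma>w^2 * V_transform tanh (q l) is an Euler scheme for
   q' = \<sigma>w^2 * (1 - C / sqrt q). The function F x = x + 2 * C * sqrt x + C^2 * ln x linearises
   this equation: F (q (l + 1)) - F (q l) = \<sigma>w^2 + O(l powr (-3/2)), an error that is summable,
   so F (q l) = \<sigma>w^2 * l + O(1). Inverting F only needs sqrt (q l) = \<sigma>w * sqrt l + O(1) and
   ln (q l) = ln l + O(1). *)

theory Submission
  imports Defs
begin

section \<open>Dependence of \<open>V_transform\<close> on the variance\<close>

text \<open>The substitution z = \<open>sqrt q * x\<close> moves the variance out of the measure and
  into the integrand. Monotonicity and the limit in q thereby reduce to pointwise facts under one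
  fixed density.\<close>

lemma V_transform_eq_std_normal:
  assumes "q > 0" and [measurable]: "\<phi> \<in> borel_measurable borel"
  shows "V_transform \<phi> q = (LBINT x. std_normal_density x * (\<phi> (sqrt q * x))\<^sup>2)"
proof -
  have "V_transform \<phi> q = (LBINT z. normal_density 0 (sqrt q) z * (\<phi> z)\<^sup>2)"
    using assms by (simp add: V_transform_def centered_gaussian_def integral_density)
  also have "\<dots> = sqrt q * (LBINT x. normal_density 0 (sqrt q) (sqrt q * x) * (\<phi> (sqrt q * x))\<^sup>2)"
    using assms(1) by (subst lborel_integral_real_affine[where c = "sqrt q" and t = 0]) auto
  also have "\<dots> = (LBINT x. sqrt q * (normal_density 0 (sqrt q) (sqrt q * x) * (\<phi> (sqrt q * x))\<^sup>2))"
    by simp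
  also have "\<dots> = (LBINT x. std_normal_density x * (\<phi> (sqrt q * x))\<^sup>2)"
    using assms(1)
    by (intro Bochner_Integration.integral_cong)
       (auto simp: normal_density_def real_sqrt_mult power_mult_distrib divide_simps)
  finally show ?thesis .
qed

lemma tanh_like_measurable: "tanh_like \<phi> \<Longrightarrow> \<phi> \<in> borel_measurable borel"
  by (auto simp: tanh_like_def intro: borel_measurable_mono)

lemma tanh_like_square_le_1: "tanh_like \<phi> \<Longrightarrow> (\<phi> x)\<^sup>2 \<le> 1"
  by (auto simp: tanh_like_def abs_square_le_1)

lemma tanh_like_square_abs:
  assumes "tanh_like \<phi>"
  shows "(\<phi> x)\<^sup>2 = (\<phi> \<bar>x\<bar>)\<^sup>2"
  using assms by (auto simp: tanh_like_def abs_if)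

text \<open>Oddness makes the square even, and on the nonnegative half-line \<open>\<phi>\<close> is
  nonnegative and increasing.\<close>

lemma tanh_like_square_mono:
  assumes "tanh_like \<phi>" "\<bar>x\<bar> \<le> \<bar>y\<bar>"
  shows "(\<phi> x)\<^sup>2 \<le> (\<phi> y)\<^sup>2"
proof -
  have "(\<phi> \<bar>x\<bar>)\<^sup>2 \<le> (\<phi> \<bar>y\<bar>)\<^sup>2"
    using assms by (intro power_mono) (auto simp: tanh_like_def mono_def)
  thus ?thesis
    using tanh_like_square_abs[OF assms(1), of x] tanh_like_square_abs[OF assms(1), of y] by simp
qed

lemma integrable_std_normal_tanh_like:
  assumes "tanh_like \<phi>"
  shows "integrable lborel (\<lambda>x. std_normal_density x * (\<phi> (s * x))\<^sup>2)"
proof (rule Bochner_Integration.integrable_bound)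
  note [measurable] = tanh_like_measurable[OF assms]
  show "(\<lambda>x. std_normal_density x * (\<phi> (s * x))\<^sup>2) \<in> borel_measurable lborel"
    by simp
  show "AE x in lborel. norm (std_normal_density x * (\<phi> (s * x))\<^sup>2) \<le> norm (std_normal_density x)"
    using tanh_like_square_le_1[OF assms]
    by (intro AE_I2) (auto simp: abs_mult intro!: mult_right_le_one_le)
qed auto

lemma V_transform_nonneg: "V_transform \<phi> q \<ge> 0"
  by (auto simp: V_transform_def)

lemma V_transform_le_1:
  assumes "tanh_like \<phi>" "q > 0"
  shows "V_transform \<phi> q \<le> 1"
proof -
  have "V_transform \<phi> q \<le> (LBINT x. std_normal_density x)"
    unfolding V_transform_eq_std_normal[OF assms(2) tanh_like_measurable[OF assms(1)]]
    using tanh_like_square_le_1[OF assms(1)]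
    by (intro integral_mono integrable_std_normal_tanh_like assms)
       (auto intro!: mult_right_le_one_le)
  thus ?thesis by simp
qed

lemma V_transform_mono:
  assumes "tanh_like \<phi>" "0 < q" "q \<le> r"
  shows "V_transform \<phi> q \<le> V_transform \<phi> r"
proof -
  have "r > 0" using assms by simp
  show ?thesis
    unfolding V_transform_eq_std_normal[OF \<open>q > 0\<close> tanh_like_measurable[OF assms(1)]]
      V_transform_eq_std_normal[OF \<open>r > 0\<close> tanh_like_measurable[OF assms(1)]]
    using assms
    by (intro integral_mono integrable_std_normal_tanh_like mult_left_mono tanh_like_square_mono)
       (auto simp: abs_mult intro!: mult_right_mono)
qed

text \<open>A vanishing integral forces \<open>\<phi> (sqrt q * x)\<close> to vanish almost
  everywhere, but \<open>\<phi>\<close> is positive from some \<open>a\<close> on, so an interval of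
  length 1 would be null. The positive value at the smallest variance later drives the linear growth
  of \<open>p\<close>.\<close>

lemma V_transform_pos:
  assumes "tanh_like \<phi>" "q > 0"
  shows "V_transform \<phi> q > 0"
proof (rule ccontr)
  assume "\<not> V_transform \<phi> q > 0"
  with V_transform_nonneg[of \<phi> q] have "V_transform \<phi> q = 0" by simp
  hence "AE x in lborel. std_normal_density x * (\<phi> (sqrt q * x))\<^sup>2 = 0"
    unfolding V_transform_eq_std_normal[OF assms(2) tanh_like_measurable[OF assms(1)]]
    by (subst (asm) integral_nonneg_eq_0_iff_AE)
       (auto intro!: integrable_std_normal_tanh_like assms)
  hence zero: "AE x in lborel. \<phi> (sqrt q * x) = 0"
    by eventually_elim (use normal_density_pos[of 1 0] in \<open>simp add: less_le\<close>)
  have "eventually (\<lambda>x. \<phi> x > 0) at_top"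
    using assms(1) order_tendstoD(1)[of \<phi> 1 at_top 0] by (auto simp: tanh_like_def)
  then obtain a where a: "\<And>x. x \<ge> a \<Longrightarrow> \<phi> x > 0"
    by (auto simp: eventually_at_top_linorder)
  from zero have "AE x in lborel. x \<notin> {a / sqrt q..a / sqrt q + 1}"
  proof eventually_elim
    case (elim x)
    have "x < a / sqrt q"
      using elim a[of "sqrt q * x"] assms(2) by (force simp: field_simps not_le)
    thus ?case by auto
  qed
  hence "emeasure lborel {a / sqrt q..a / sqrt q + 1} = 0"
    by (subst (asm) AE_iff_measurable[of "{a / sqrt q..a / sqrt q + 1}"]) auto
  thus False
    by (subst (asm) emeasure_lborel_Icc) auto
qed

text \<open>Dominated convergence with the density itself as majorant. The integrand converges to
  the density except at x = 0, which is a null set.\<close>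

lemma V_transform_tendsto_1:
  assumes "tanh_like \<phi>"
  shows "(V_transform \<phi> \<longlongrightarrow> 1) at_top"
proof -
  note [measurable] = tanh_like_measurable[OF assms]
  have "((\<lambda>t. LBINT x. std_normal_density x * (\<phi> (t * x))\<^sup>2) \<longlongrightarrow> (LBINT x. std_normal_density x)) at_top"
  proof (rule integral_dominated_convergence_at_top[where w = std_normal_density])
    show "\<forall>\<^sub>F t in at_top. AE x in lborel. norm (std_normal_density x * (\<phi> (t * x))\<^sup>2) \<le> std_normal_density x"
      using tanh_like_square_le_1[OF assms]
      by (intro always_eventually allI AE_I2) (auto simp: abs_mult intro!: mult_right_le_one_le)
    have lim: "((\<lambda>t. std_normal_density x * (\<phi> (t * x))\<^sup>2) \<longlongrightarrow> std_normal_density x) at_top"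
      if "x \<noteq> 0" for x
    proof -
      \<comment> \<open>The limit of \<open>\<phi>\<close> is given at plus infinity only, so it is
        taken along \<open>t * \<bar>x\<bar>\<close>; evenness of the square then covers negative
        x.\<close>
      have "filterlim (\<lambda>t. t * \<bar>x\<bar>) at_top at_top"
        using that by (subst mult.commute)
          (auto intro!: filterlim_tendsto_pos_mult_at_top[OF tendsto_const] simp: filterlim_ident)
      hence "((\<lambda>t. \<phi> (t * \<bar>x\<bar>)) \<longlongrightarrow> 1) at_top"
        using assms by (auto simp: tanh_like_def intro: filterlim_compose)
      hence "((\<lambda>t. std_normal_density x * (\<phi> (t * \<bar>x\<bar>))\<^sup>2) \<longlongrightarrow> std_normal_density x * 1\<^sup>2) at_top"
        by (intro tendsto_intros)
      moreover have "(\<phi> (t * \<bar>x\<bar>))\<^sup>2 = (\<phi> (t * x))\<^sup>2" for t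
        by (intro antisym tanh_like_square_mono assms) (auto simp: abs_mult)
      ultimately show ?thesis by simp
    qed
    show "AE x in lborel. ((\<lambda>t. std_normal_density x * (\<phi> (t * x))\<^sup>2) \<longlongrightarrow> std_normal_density x) at_top"
      using AE_lborel_singleton[of "0::real"] by eventually_elim (rule lim)
  qed auto
  hence "((\<lambda>t. LBINT x. std_normal_density x * (\<phi> (t * x))\<^sup>2) \<longlongrightarrow> 1) at_top"
    by simp
  from filterlim_compose[OF this sqrt_at_top]
  show ?thesis
    by (rule Lim_transform_eventually)
       (auto intro!: eventually_mono[OF eventually_gt_at_top[of 0]]
             simp: V_transform_eq_std_normal)
qed

section \<open>Expansion of the transform of tanh for large variance\<close>

lemma tanh_like_tanh: "tanh_like tanh"
  using tanh_real_bounds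
  by (auto simp: tanh_like_def mono_def abs_le_iff less_imp_le tanh_real_at_top minus_le_iff)

text \<open>The integrand is the derivative of tanh, whose limits are 1 and -1. Since it is
  nonnegative, the fundamental theorem yields integrability together with the value.\<close>

lemma has_bochner_integral_sech_square:
  "has_bochner_integral lborel (\<lambda>x::real. 1 - (tanh x)\<^sup>2) 2"
proof -
  have nn: "0 \<le> 1 - (tanh x)\<^sup>2" for x :: real
    using tanh_like_square_le_1[OF tanh_like_tanh] by simp
  have top: "((tanh \<circ> real_of_ereal) \<longlongrightarrow> (1::real)) (at_left \<infinity>)"
    by (simp add: ereal_tendsto_simps tanh_real_at_top)
  have bot: "((tanh \<circ> real_of_ereal) \<longlongrightarrow> (-1::real)) (at_right (-\<infinity>))"
    by (simp add: ereal_tendsto_simps tanh_real_at_bot)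
  have *: "set_integrable lborel (einterval (-\<infinity>) \<infinity>) (\<lambda>x::real. 1 - (tanh x)\<^sup>2)"
          "(LBINT x=-\<infinity>..\<infinity>. 1 - (tanh (x::real))\<^sup>2) = 1 - (-1)"
    by (rule interval_integral_FTC_nonneg[OF _ _ _ _ bot top];
        use nn in \<open>auto intro!: derivative_eq_intros continuous_intros AE_I2\<close>)+
  thus ?thesis
    by (auto simp: has_bochner_integral_iff set_integrable_def interval_lebesgue_integral_def
                   set_lebesgue_integral_def)
qed

text \<open>Provides an integrable majorant for the second moment of sech^2. With c = cosh (x/2),
  one has |x/2| \<le> 2c and c^2 \<le> 2c^2 - 1 = cosh x, hence x^2 c^2 \<le> 16 c^4 \<le> 16 (cosh
  x)^2.\<close>

lemma square_times_sech_square_le: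
  fixes x :: real
  shows "x\<^sup>2 * (1 - (tanh x)\<^sup>2) \<le> 16 * (1 - (tanh (x / 2))\<^sup>2)"
proof -
  define c where "c = cosh (x / 2)"
  have c: "c \<ge> 1" by (auto simp: c_def cosh_real_ge_1)
  have sech: "1 - (tanh y)\<^sup>2 = 1 / (cosh y)\<^sup>2" for y :: real
  proof -
    have "1 - (tanh y)\<^sup>2 = ((cosh y)\<^sup>2 - (sinh y)\<^sup>2) / (cosh y)\<^sup>2"
      using cosh_real_pos[of y] by (simp add: tanh_def power_divide diff_divide_distrib)
    thus ?thesis by (simp add: cosh_square_eq)
  qed
  have cx: "cosh x = 2 * c\<^sup>2 - 1"
    using cosh_double[of "x / 2"] cosh_square_eq[of "x/2"] by (simp add: c_def)
  have "\<bar>y\<bar> \<le> 2 * cosh y" for y :: real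
  proof -
    have "\<bar>y\<bar> \<le> exp \<bar>y\<bar>"
      using exp_ge_add_one_self[of "\<bar>y\<bar>"] by linarith
    also have "\<dots> \<le> exp y + exp (- y)"
      by (auto simp: abs_if)
    finally show ?thesis by (simp add: cosh_field_def)
  qed
  hence "\<bar>x / 2\<bar> \<le> 2 * c" unfolding c_def .
  from power_mono[OF this, of 2] have "x\<^sup>2 * c\<^sup>2 \<le> 16 * c\<^sup>2 * c\<^sup>2"
    by (intro mult_right_mono) (auto simp: power_divide power_mult_distrib)
  also have "\<dots> \<le> 16 * (cosh x)\<^sup>2"
  proof -
    have "c\<^sup>2 \<le> cosh x" using c by (simp add: cx)
    hence "(c\<^sup>2)\<^sup>2 \<le> (cosh x)\<^sup>2" by (intro power_mono) auto
    thus ?thesis by (simp add: power2_eq_square)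
  qed
  finally show ?thesis
    using c cosh_real_pos[of x] unfolding sech c_def[symmetric] by (simp add: field_simps)
qed

text \<open>\<open>1 - V_transform tanh q\<close> is \<open>1 / sqrt (2 \<pi> q)\<close> times the integral of
  \<open>sech\<^sup>2 x * exp (- x\<^sup>2 / (2 q))\<close>, and the exponential differs from 1 by at most \<open>x\<^sup>2 / (2 q)\<close>.\<close>
lemma V_transform_tanh_expansion:
  obtains K :: real where "K \<ge> 0"
    "\<And>q. q > 0 \<Longrightarrow> \<bar>V_transform tanh q - (1 - sqrt (2 / pi) / sqrt q)\<bar> \<le> K / (q * sqrt q)"
proof -
  define J where "J = (LBINT x::real. x\<^sup>2 * (1 - (tanh x)\<^sup>2))"
  have nn: "0 \<le> 1 - (tanh x)\<^sup>2" for x :: real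
    using tanh_like_square_le_1[OF tanh_like_tanh] by simp
  have [measurable]: "(tanh :: real \<Rightarrow> real) \<in> borel_measurable borel"
    by (intro tanh_like_measurable tanh_like_tanh)
  have int: "integrable lborel (\<lambda>x::real. 1 - (tanh x)\<^sup>2)"
    and int2: "(LBINT x::real. 1 - (tanh x)\<^sup>2) = 2"
    using has_bochner_integral_sech_square by (simp_all add: has_bochner_integral_iff)
  have intJ: "integrable lborel (\<lambda>x::real. x\<^sup>2 * (1 - (tanh x)\<^sup>2))"
  proof (rule Bochner_Integration.integrable_bound)
    show "integrable lborel (\<lambda>x::real. 16 * (1 - (tanh (x / 2))\<^sup>2))"
      using lborel_integrable_real_affine[OF int, of "1/2" 0]
      by (intro integrable_mult_right) simp
    show "AE x in lborel. norm (x\<^sup>2 * (1 - (tanh x)\<^sup>2)) \<le> norm (16 * (1 - (tanh (x / 2 :: real))\<^sup>2))"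
      using nn square_times_sech_square_le by (intro AE_I2) (auto simp: abs_mult)
  qed auto
  have J: "J \<ge> 0" using nn by (auto simp: J_def)
  show ?thesis
  proof
    show "J / (2 * sqrt (2 * pi)) \<ge> 0" using J by simp
    fix q :: real assume q: "q > 0"
    define I where "I = (LBINT x::real. (1 - (tanh x)\<^sup>2) * exp (- x\<^sup>2 / (2 * q)))"
    have intI: "integrable lborel (\<lambda>x::real. (1 - (tanh x)\<^sup>2) * exp (- x\<^sup>2 / (2 * q)))"
      using nn q by (intro Bochner_Integration.integrable_bound[OF int])
                    (auto simp: abs_mult intro!: mult_right_le_one_le AE_I2)
    have dens: "normal_density 0 (sqrt q) x = exp (- x\<^sup>2 / (2 * q)) / sqrt (2 * pi * q)" for x
      using q by (simp add: normal_density_def)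
    have "V_transform tanh q = (LBINT z. normal_density 0 (sqrt q) z * (tanh z)\<^sup>2)"
      using q by (simp add: V_transform_def centered_gaussian_def integral_density)
    \<comment> \<open>Writing tanh^2 as 1 - sech^2 splits off the total mass 1 of the
      density.\<close>
    also have "\<dots> = (LBINT z. normal_density 0 (sqrt q) z -
                        (1 - (tanh z)\<^sup>2) * exp (- z\<^sup>2 / (2 * q)) / sqrt (2 * pi * q))"
      by (intro Bochner_Integration.integral_cong) (auto simp: dens diff_divide_distrib algebra_simps)
    also have "\<dots> = 1 - I / sqrt (2 * pi * q)"
      using q intI by (subst Bochner_Integration.integral_diff) (auto simp: I_def)
    finally have V: "V_transform tanh q = 1 - I / sqrt (2 * pi * q)" .
    have "I \<le> (LBINT x::real. 1 - (tanh x)\<^sup>2)"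
      unfolding I_def using nn q
      by (intro integral_mono intI int) (auto intro!: mult_right_le_one_le)
    hence "I \<le> 2" by (simp only: int2)
    moreover have "2 - J / (2 * q) \<le> I"
    proof -
      have "2 - J / (2 * q) = (LBINT x::real. (1 - (tanh x)\<^sup>2) - x\<^sup>2 * (1 - (tanh x)\<^sup>2) / (2 * q))"
        using int intJ int2 by (subst Bochner_Integration.integral_diff) (auto simp: J_def)
      also have "\<dots> \<le> I"
        unfolding I_def
      proof (intro integral_mono intI)
        fix x :: real
        have "1 - x\<^sup>2 / (2 * q) \<le> exp (- x\<^sup>2 / (2 * q))"
          using exp_ge_add_one_self[of "- x\<^sup>2 / (2 * q)"] by simp
        from mult_left_mono[OF this nn[of x]]
        show "(1 - (tanh x)\<^sup>2) - x\<^sup>2 * (1 - (tanh x)\<^sup>2) / (2 * q)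
                 \<le> (1 - (tanh x)\<^sup>2) * exp (- x\<^sup>2 / (2 * q))"
          by (simp add: algebra_simps)
      qed (use int intJ in auto)
      finally show ?thesis .
    qed
    ultimately have "\<bar>2 - I\<bar> \<le> J / (2 * q)" by simp
    moreover have "V_transform tanh q - (1 - sqrt (2 / pi) / sqrt q) = (2 - I) / sqrt (2 * pi * q)"
    proof -
      \<comment> \<open>The constant C arises here: the numerator 2 is the integral of
        sech^2.\<close>
      have "sqrt (2 / pi) / sqrt q = 2 / sqrt (2 * pi * q)"
        using q by (simp add: real_sqrt_mult real_sqrt_divide field_simps)
      thus ?thesis by (simp add: V diff_divide_distrib)
    qed
    ultimately have "\<bar>V_transform tanh q - (1 - sqrt (2 / pi) / sqrt q)\<bar>
                       \<le> J / (2 * q) / sqrt (2 * pi * q)"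
      using q divide_right_mono[of "\<bar>2 - I\<bar>" "J / (2 * q)" "sqrt (2 * pi * q)"]
      by (simp add: abs_divide)
    also have "\<dots> = J / (2 * sqrt (2 * pi)) / (q * sqrt q)"
      by (simp add: real_sqrt_mult)
    finally show "\<bar>V_transform tanh q - (1 - sqrt (2 / pi) / sqrt q)\<bar>
                    \<le> J / (2 * sqrt (2 * pi)) / (q * sqrt q)" .
  qed
qed

section \<open>From increments to averages of a sequence\<close>

text \<open>A Stolz-Cesaro argument: after subtracting \<open>L * real n\<close>, the increments are
  eventually below e/2 in absolute value, so the remainder is at most a constant plus
  \<open>e / 2 * real n\<close>, and the constant disappears after division by n.\<close>

lemma increments_tendsto_imp_average_tendsto:
  fixes a :: "nat \<Rightarrow> real"
  assumes "(\<lambda>n. a (Suc n) - a n) \<longlonglongrightarrow> L"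
  shows "(\<lambda>n. a n / real n) \<longlonglongrightarrow> L"
proof (rule tendstoI)
  fix e :: real assume e: "e > 0"
  define c where "c n = a n - L * real n" for n
  from tendstoD[OF assms, of "e / 2"] e obtain N where
    N: "\<And>n. n \<ge> N \<Longrightarrow> \<bar>a (Suc n) - a n - L\<bar> < e / 2"
    by (auto simp: eventually_sequentially dist_real_def)
  have step: "\<bar>c n\<bar> \<le> \<bar>c N\<bar> + e / 2 * real n" if "n \<ge> N" for n
    using that
  proof (induction n rule: dec_induct)
    case base
    thus ?case using e by simp
  next
    case (step n)
    have "c (Suc n) = c n + (a (Suc n) - a n - L)" by (simp add: c_def algebra_simps)
    moreover have "e / 2 * real (Suc n) = e / 2 * real n + e / 2" by (simp add: algebra_simps)
    ultimately show ?case using step.IH N[OF step.hyps(1)] by linarith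
  qed
  have "(\<lambda>n. \<bar>c N\<bar> / real n) \<longlonglongrightarrow> 0" by (rule lim_const_over_n)
  hence "eventually (\<lambda>n. \<bar>c N\<bar> / real n < e / 2) sequentially"
    using e by (intro order_tendstoD(2)) auto
  thus "eventually (\<lambda>n. dist (a n / real n) L < e) sequentially"
    using eventually_ge_at_top[of N] eventually_gt_at_top[of 0]
  proof eventually_elim
    case (elim n)
    have "\<bar>c n\<bar> / real n \<le> (\<bar>c N\<bar> + e / 2 * real n) / real n"
      using step[OF elim(2)] by (intro divide_right_mono) auto
    also have "\<dots> < e" using elim by (simp add: field_simps)
    finally have "\<bar>c n / real n\<bar> < e" by simp
    moreover have "a n / real n - L = c n / real n" using elim by (simp add: c_def field_simps)
    ultimately show ?case by (simp add: dist_real_def)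
  qed
qed

text \<open>Turns the limit into a usable lower bound. The second conjunct ensures that the sequence
  is eventually at least 1, as the increment estimate for \<open>lyap\<close> requires.\<close>

lemma average_tendsto_imp_eventually_linear:
  fixes a :: "nat \<Rightarrow> real"
  assumes "(\<lambda>n. a n / real n) \<longlonglongrightarrow> L" "L > 0"
  shows "eventually (\<lambda>n. a n \<ge> L / 2 * real n \<and> L / 2 * real n \<ge> 1) sequentially"
proof -
  have "eventually (\<lambda>n. a n / real n > L / 2) sequentially"
    using assms by (intro order_tendstoD(1)) auto
  moreover have "eventually (\<lambda>n. real n \<ge> 2 / L) sequentially"
    using filterlim_real_sequentially by (simp add: filterlim_at_top)
  ultimately show ?thesis
    using eventually_gt_at_top[of 0]
    by eventually_elim (use assms(2) in \<open>auto simp: field_simps\<close>)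
qed

section \<open>Increments of \<open>sqrt\<close>, \<open>ln\<close> and \<open>lyap\<close>\<close>

text \<open>With r = \<open>sqrt x\<close> and t = \<open>sqrt (x + d)\<close>, the linearisation
  error is exactly (t - r)^2 / (2r) in absolute value, and t - r = d / (t + r) \<le> d / r.\<close>

lemma sqrt_increment_bound:
  fixes x d :: real
  assumes "x > 0" "d \<ge> 0"
  shows "\<bar>sqrt (x + d) - sqrt x - d / (2 * sqrt x)\<bar> \<le> d\<^sup>2 / (x * sqrt x)"
proof -
  define r t where "r = sqrt x" and "t = sqrt (x + d)"
  have r: "r > 0" "r \<le> t" "x = r\<^sup>2" "d = t\<^sup>2 - r\<^sup>2"
    using assms by (auto simp: r_def t_def)
  have "d / (2 * r) - (t - r) = (t - r)\<^sup>2 / (2 * r)"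
    using r by (simp add: field_simps power2_eq_square)
  moreover have "(t - r)\<^sup>2 / (2 * r) \<le> d\<^sup>2 / (x * r)"
  proof -
    have "d\<^sup>2 = (t - r)\<^sup>2 * (t + r)\<^sup>2"
      unfolding r(4) by (simp add: power2_eq_square algebra_simps)
    moreover have "r\<^sup>2 \<le> (t + r)\<^sup>2" using r by (intro power_mono) auto
    ultimately have "(t - r)\<^sup>2 * r\<^sup>2 \<le> d\<^sup>2" by (simp add: mult_left_mono)
    hence "(t - r)\<^sup>2 * r\<^sup>2 \<le> d\<^sup>2 * 2" using zero_le_power2[of d] by linarith
    thus ?thesis unfolding r(3) using r(1) by (simp add: field_simps)
  qed
  moreover have "(t - r)\<^sup>2 / (2 * r) \<ge> 0" using r by simp
  ultimately show ?thesis unfolding r_def[symmetric] t_def[symmetric] by linarith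
qed

text \<open>For y = d / x, the value ln (1 + y) lies between y - y^2 and y; the lower bound comes
  from applying ln u \<le> u - 1 at u = 1 / (1 + y).\<close>

lemma ln_increment_bound:
  fixes x d :: real
  assumes "x > 0" "d \<ge> 0"
  shows "\<bar>ln (x + d) - ln x - d / x\<bar> \<le> d\<^sup>2 / x\<^sup>2"
proof -
  have ln_eq: "ln (x + d) - ln x = ln (1 + d / x)"
    using assms ln_divide_pos[of "x + d" x] by (simp add: add_divide_distrib)
  have "ln (1 + d / x) \<le> d / x"
    using assms by (intro ln_add_one_self_le_self) auto
  moreover have "d / x - (d / x)\<^sup>2 \<le> ln (1 + d / x)"
  proof -
    define y where "y = d / x"
    have y: "y \<ge> 0" using assms by (simp add: y_def)
    have "y - y\<^sup>2 \<le> 1 - 1 / (1 + y)"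
      using y by (simp add: field_simps power2_eq_square)
    also have "\<dots> \<le> ln (1 + y)"
      using ln_le_minus_one[of "1 / (1 + y)"] y by (simp add: ln_div)
    finally show ?thesis by (simp add: y_def)
  qed
  ultimately show ?thesis by (simp add: ln_eq power_divide)
qed

text \<open>An approximate primitive of \<open>1 / (1 - C / sqrt x)\<close>, so that \<open>lyap\<close> grows by \<open>s\<^sup>2\<close>
  per step of \<open>x \<mapsto> x + s\<^sup>2 * (1 - C / sqrt x)\<close>, up to a summable error.\<close>
definition lyap :: "real \<Rightarrow> real \<Rightarrow> real" where
  "lyap C x = x + 2 * C * sqrt x + C\<^sup>2 * ln x"

text \<open>The increment splits into its linear part, the linearisation errors \<open>e1\<close> of
  sqrt and \<open>e2\<close> of ln, and the error \<open>e3\<close> of the expansion of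
  \<open>v\<close>. Each contributes at most a constant over \<open>x * sqrt x\<close>;
  \<open>x \<ge> 1\<close> absorbs the higher negative powers of x.\<close>

lemma lyap_increment_bound:
  fixes x v s C K :: real
  assumes "x \<ge> 1" "0 \<le> v" "v \<le> 1" "C \<ge> 0" "K \<ge> 0"
    and v: "\<bar>v - (1 - C / sqrt x)\<bar> \<le> K / (x * sqrt x)"
  shows "\<bar>lyap C (x + s\<^sup>2 * v) - lyap C x - s\<^sup>2\<bar> \<le>
           (s\<^sup>2 * (K * (1 + C + C\<^sup>2) + C ^ 3) + (2 * C + C\<^sup>2) * s ^ 4) / (x * sqrt x)"
proof -
  define r d where "r = sqrt x" and "d = s\<^sup>2 * v"
  define R where "R = x * r"
  have r: "r \<ge> 1" "x = r\<^sup>2" using assms(1) by (auto simp: r_def)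
  have R: "R = r ^ 3" "R > 0"
    using r by (auto simp: R_def power_numeral_reduce intro!: mult_pos_pos)
  have d: "d \<ge> 0" "d\<^sup>2 \<le> s ^ 4"
  proof -
    show "d \<ge> 0" using assms by (simp add: d_def)
    have "d \<le> s\<^sup>2" using assms by (simp add: d_def mult_left_le)
    hence "d\<^sup>2 \<le> (s\<^sup>2)\<^sup>2" using \<open>d \<ge> 0\<close> by (intro power_mono) auto
    thus "d\<^sup>2 \<le> s ^ 4" by simp
  qed
  define e1 e2 e3 where "e1 = sqrt (x + d) - r - d / (2 * r)" and "e2 = ln (x + d) - ln x - d / x"
    and "e3 = v - (1 - C / r)"
  have "\<bar>e1\<bar> \<le> d\<^sup>2 / R"
    using sqrt_increment_bound[of x d] assms(1) d by (simp add: e1_def r_def R_def)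
  also have "\<dots> \<le> s ^ 4 / R" using d R by (intro divide_right_mono) auto
  finally have e1: "\<bar>2 * C * e1\<bar> \<le> 2 * C * (s ^ 4 / R)"
    using assms by (simp add: abs_mult mult_left_mono del: times_divide_eq_right)
  have "\<bar>e2\<bar> \<le> d\<^sup>2 / x\<^sup>2"
    using ln_increment_bound[of x d] assms(1) d by (simp add: e2_def)
  also have "\<dots> \<le> s ^ 4 / R"
    using d R r by (intro frac_le) (auto simp: R(1) simp flip: power_mult intro: power_increasing)
  finally have e2: "\<bar>C\<^sup>2 * e2\<bar> \<le> C\<^sup>2 * (s ^ 4 / R)"
    by (simp add: abs_mult mult_left_mono del: times_divide_eq_right)
  have e3: "\<bar>s\<^sup>2 * (e3 * (1 + C / r + C\<^sup>2 / r\<^sup>2))\<bar> \<le> s\<^sup>2 * (K / R * (1 + C + C\<^sup>2))"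
  proof -
    have "C / r \<le> C" "C\<^sup>2 / r\<^sup>2 \<le> C\<^sup>2" "0 \<le> C / r" "0 \<le> C\<^sup>2 / r\<^sup>2"
      using assms r by (auto simp: divide_le_eq mult_le_cancel_left1)
    hence "\<bar>1 + C / r + C\<^sup>2 / r\<^sup>2\<bar> \<le> 1 + C + C\<^sup>2" by linarith
    moreover have "\<bar>e3\<bar> \<le> K / R" using v by (simp add: e3_def R_def r_def)
    ultimately have "\<bar>e3 * (1 + C / r + C\<^sup>2 / r\<^sup>2)\<bar> \<le> K / R * (1 + C + C\<^sup>2)"
      unfolding abs_mult by (intro mult_mono) (use assms R in auto)
    thus ?thesis unfolding abs_mult[of "s\<^sup>2"] by (simp only: abs_power2 mult_left_mono zero_le_power2)
  qed
  have C3: "\<bar>s\<^sup>2 * (C ^ 3 / R)\<bar> = s\<^sup>2 * (C ^ 3 / R)"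
    using assms R by (intro abs_of_nonneg) auto
  have "lyap C (x + d) - lyap C x - s\<^sup>2 =
          (d + 2 * C * (d / (2 * r)) + C\<^sup>2 * (d / x)) - s\<^sup>2 + 2 * C * e1 + C\<^sup>2 * e2"
    by (simp add: lyap_def e1_def e2_def r_def algebra_simps)
  \<comment> \<open>The coefficients of \<open>lyap\<close> are chosen for this cancellation: with a
    = C / r, the product (1 - a)(1 + a + a^2) equals 1 - a^3, so nothing of order 1/r or 1/r^2
    survives.\<close>
  also have "(d + 2 * C * (d / (2 * r)) + C\<^sup>2 * (d / x)) - s\<^sup>2 =
               s\<^sup>2 * (e3 * (1 + C / r + C\<^sup>2 / r\<^sup>2)) - s\<^sup>2 * (C ^ 3 / R)"
    using r by (simp add: d_def e3_def R(1) field_simps power2_eq_square power3_eq_cube)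
  finally have "\<bar>lyap C (x + d) - lyap C x - s\<^sup>2\<bar> \<le>
      s\<^sup>2 * (K / R * (1 + C + C\<^sup>2)) + s\<^sup>2 * (C ^ 3 / R) + 2 * C * (s ^ 4 / R) + C\<^sup>2 * (s ^ 4 / R)"
    using e1 e2 e3 C3 by linarith
  also have "\<dots> = (s\<^sup>2 * (K * (1 + C + C\<^sup>2) + C ^ 3) + (2 * C + C\<^sup>2) * s ^ 4) / R"
    by (simp add: add_divide_distrib algebra_simps)
  finally show ?thesis by (simp add: d_def R_def r_def)
qed

section \<open>Asymptotics of an abstract recursion with linear growth\<close>

text \<open>Linear growth turns the increment error into O(l^(-3/2)), which is summable; the partial
  sums of the errors telescope to the sequence in question, up to a constant.\<close>

lemma linear_growth_lyap_bounded:
  fixes q :: "nat \<Rightarrow> real" and v :: "real \<Rightarrow> real" and s C K :: real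
  assumes "s > 0" "C \<ge> 0" "K \<ge> 0"
    and rec: "\<And>l. l \<ge> 1 \<Longrightarrow> q (Suc l) = q l + s\<^sup>2 * v (q l)"
    and v01: "\<And>x. x > 0 \<Longrightarrow> 0 \<le> v x \<and> v x \<le> 1"
    and v: "\<And>x. x > 0 \<Longrightarrow> \<bar>v x - (1 - C / sqrt x)\<bar> \<le> K / (x * sqrt x)"
    and lim: "(\<lambda>l. q l / real l) \<longlonglongrightarrow> s\<^sup>2"
  shows "Bseq (\<lambda>l. lyap C (q l) - s\<^sup>2 * real l)"
proof -
  define M where "M = s\<^sup>2 * (K * (1 + C + C\<^sup>2) + C ^ 3) + (2 * C + C\<^sup>2) * s ^ 4"
  define g where "g l = lyap C (q (Suc l)) - lyap C (q l) - s\<^sup>2" for l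
  have "M \<ge> 0" using assms by (simp add: M_def)
  have "s\<^sup>2 > 0" using assms by simp
  from average_tendsto_imp_eventually_linear[OF lim this]
  have "eventually (\<lambda>l. norm (g l) \<le> M * (s\<^sup>2 / 2) powr (-3/2) * norm (real l powr (-3/2))) sequentially"
    using eventually_ge_at_top[of 1]
  proof eventually_elim
    case (elim l)
    hence ql: "q l \<ge> s\<^sup>2 / 2 * real l" "s\<^sup>2 / 2 * real l \<ge> 1" and q1: "q l \<ge> 1"
      by auto
    have "norm (g l) \<le> M / (q l * sqrt (q l))"
      using lyap_increment_bound[of "q l" "v (q l)" C K s] q1 v01[of "q l"] v[of "q l"] assms elim
      by (simp add: g_def M_def rec)
    also have "q l * sqrt (q l) = q l powr (3/2)"
      using q1 powr_add[of "q l" 1 "1/2"] by (simp add: powr_half_sqrt)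
    also have "M / q l powr (3/2) = M * q l powr (-3/2)"
      using powr_minus_divide[of "q l" "3/2"] by simp
    also have "\<dots> \<le> M * (s\<^sup>2 / 2 * real l) powr (-3/2)"
      using ql \<open>M \<ge> 0\<close> by (intro mult_left_mono powr_mono2') auto
    also have "(s\<^sup>2 / 2 * real l) powr (-3/2) = (s\<^sup>2 / 2) powr (-3/2) * real l powr (-3/2)"
      by (rule powr_mult)
    finally show ?case by (simp add: mult.assoc)
  qed
  hence "g \<in> O(\<lambda>l. real l powr (-3/2))"
    by (rule bigoI)
  hence "summable g"
    by (rule summable_comparison_test_bigo[rotated]) (simp add: summable_real_powr_iff)
  hence "Bseq (\<lambda>n. \<Sum>l<n. g l)"
    by (intro convergent_imp_Bseq) (simp add: summable_iff_convergent)
  \<comment> \<open>The sum starts at index 0, where the recursion says nothing. This is harmless: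
    \<open>g\<close> is estimated only eventually, and \<open>lyap C (q 0)\<close> is some fixed
    real number because \<open>ln\<close> is total.\<close>
  also have "(\<lambda>n. \<Sum>l<n. g l) = (\<lambda>n. (lyap C (q n) - s\<^sup>2 * real n) + - lyap C (q 0))"
  proof
    fix n
    have "(\<Sum>l<n. g l) = (\<Sum>l<n. lyap C (q (Suc l)) - lyap C (q l)) - (\<Sum>l<n. s\<^sup>2)"
      unfolding g_def by (rule sum_subtractf)
    also have "\<dots> = lyap C (q n) - lyap C (q 0) - (\<Sum>l<n. s\<^sup>2)"
      by (subst sum_lessThan_telescope) (rule refl)
    finally have "(\<Sum>l<n. g l) = lyap C (q n) - lyap C (q 0) - (\<Sum>l<n. s\<^sup>2)" .
    thus "(\<Sum>l<n. g l) = (lyap C (q n) - s\<^sup>2 * real n) + - lyap C (q 0)" by simp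
  qed
  finally show ?thesis by (simp only: Bseq_add_iff)
qed

text \<open>No inverse of \<open>lyap\<close> is formed: the claimed remainder equals the bounded
  quantity minus 2C times the error of replacing \<open>sqrt (q l)\<close> by
  \<open>s * sqrt (real l)\<close>, minus C^2 times the error of replacing \<open>ln (q l)\<close>
  by \<open>ln (real l)\<close>.\<close>

lemma lyap_bounded_imp_expansion:
  fixes q :: "nat \<Rightarrow> real" and s C :: real
  assumes "s > 0" "C \<ge> 0"
    and lim: "(\<lambda>l. q l / real l) \<longlonglongrightarrow> s\<^sup>2"
    and bdd: "Bseq (\<lambda>l. lyap C (q l) - s\<^sup>2 * real l)"
  shows "(\<lambda>l. q l - (s\<^sup>2 * real l - 2 * C * s * sqrt (real l) - C\<^sup>2 * ln (real l))) \<in> O(\<lambda>_. 1)"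
proof -
  from bdd obtain B where B: "B > 0" "\<And>l. \<bar>lyap C (q l) - s\<^sup>2 * real l\<bar> \<le> B"
    by (auto simp: Bseq_def)
  have "s\<^sup>2 > 0" using assms by simp
  from average_tendsto_imp_eventually_linear[OF lim this]
  have q1: "eventually (\<lambda>l. q l \<ge> 1) sequentially"
    by eventually_elim auto
  have lyap: "(\<lambda>l. lyap C (q l) - s\<^sup>2 * real l) \<in> O(\<lambda>_. 1)"
    using B by (intro bigoI[of _ B]) auto
  have sqrt: "(\<lambda>l. sqrt (q l) - s * sqrt (real l)) \<in> O(\<lambda>_. 1)"
  proof (rule bigoI)
    show "eventually (\<lambda>l. norm (sqrt (q l) - s * sqrt (real l)) \<le> (B + 2 * C + 2 * C\<^sup>2) * norm (1::real)) sequentially"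
      using q1
    proof eventually_elim
      case (elim l)
      define t u where "t = sqrt (q l)" and "u = s * sqrt (real l)"
      have t: "t \<ge> 1" "q l = t\<^sup>2" and u: "u \<ge> 0" "s\<^sup>2 * real l = u\<^sup>2"
        using elim assms by (auto simp: t_def u_def power_mult_distrib)
      \<comment> \<open>Both correction terms of \<open>lyap\<close> are O(t), hence so is t^2 -
        u^2. Factoring it as (t - u)(t + u) with t + u \<ge> t allows division by t, which leaves t
        - u bounded.\<close>
      have ln: "0 \<le> ln (q l)" "ln (q l) \<le> 2 * t"
        using t ln_le_minus_one[of t] by (auto simp: ln_realpow)
      hence ln': "0 \<le> C\<^sup>2 * ln (q l)" "C\<^sup>2 * ln (q l) \<le> 2 * C\<^sup>2 * t"
        using mult_left_mono[of "ln (q l)" "2 * t" "C\<^sup>2"] by (auto simp: mult_ac)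
      have "lyap C (q l) - s\<^sup>2 * real l = t\<^sup>2 + 2 * C * t + C\<^sup>2 * ln (q l) - u\<^sup>2"
        using t u by (simp add: lyap_def)
      with B(2)[of l] have "\<bar>t\<^sup>2 + 2 * C * t + C\<^sup>2 * ln (q l) - u\<^sup>2\<bar> \<le> B" by simp
      moreover have "0 \<le> 2 * C * t" using assms t by simp
      ultimately have "\<bar>t\<^sup>2 - u\<^sup>2\<bar> \<le> B + 2 * C * t + 2 * C\<^sup>2 * t" using ln' by linarith
      also have "\<dots> \<le> (B + 2 * C + 2 * C\<^sup>2) * t"
        using B(1) t mult_left_mono[of 1 t B] by (simp add: algebra_simps)
      finally have "\<bar>t\<^sup>2 - u\<^sup>2\<bar> \<le> (B + 2 * C + 2 * C\<^sup>2) * t" .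
      moreover have "\<bar>t - u\<bar> * t \<le> \<bar>t - u\<bar> * \<bar>t + u\<bar>"
        using t u by (intro mult_left_mono) auto
      moreover have "\<bar>t - u\<bar> * \<bar>t + u\<bar> = \<bar>t\<^sup>2 - u\<^sup>2\<bar>"
        by (simp add: power2_eq_square algebra_simps flip: abs_mult)
      ultimately have "\<bar>t - u\<bar> * t \<le> (B + 2 * C + 2 * C\<^sup>2) * t" by linarith
      hence "\<bar>t - u\<bar> \<le> B + 2 * C + 2 * C\<^sup>2" using t by simp
      thus ?case by (simp add: t_def u_def)
    qed
  qed
  have ln: "(\<lambda>l. ln (q l) - ln (real l)) \<in> O(\<lambda>_. 1)"
  proof -
    \<comment> \<open>The difference of logarithms even converges, since the ratio has a positive
      limit.\<close>
    have "(\<lambda>l. ln (q l / real l)) \<longlonglongrightarrow> ln (s\<^sup>2)"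
      using assms by (intro tendsto_ln lim) auto
    hence "(\<lambda>l. ln (q l / real l)) \<in> O(\<lambda>_. 1)"
      by (intro bigoI_tendsto[where c = "ln (s\<^sup>2)"]) auto
    moreover have "eventually (\<lambda>l. ln (q l / real l) = ln (q l) - ln (real l)) sequentially"
      using q1 eventually_gt_at_top[of 0] by eventually_elim (simp add: ln_div)
    ultimately show ?thesis by (simp cong: landau_o.big.in_cong)
  qed
  have "(\<lambda>l. (lyap C (q l) - s\<^sup>2 * real l) - 2 * C * (sqrt (q l) - s * sqrt (real l))
              - C\<^sup>2 * (ln (q l) - ln (real l))) \<in> O(\<lambda>_. 1)"
    by (intro sum_in_bigo lyap landau_o.big.cmult_in_iff' | simp add: sqrt ln)+
  thus ?thesis by (simp add: lyap_def algebra_simps)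
qed

section \<open>Asymptotics of the length quantities\<close>

theorem theoremB2:
  fixes \<phi> :: "real \<Rightarrow> real" and \<sigma>w \<sigma>b C :: real and p q :: "nat \<Rightarrow> real"
  assumes "tanh_like \<phi>"
    and "\<sigma>w \<ge> 0" and "\<sigma>b > 0" and "p 0 \<ge> 0"
    and "RRN_length_quantities \<phi> \<sigma>w \<sigma>b p q"
    and "C = sqrt (2 / pi)"
  shows "(\<sigma>w = 0 \<longrightarrow>
            (\<forall>l\<ge>1. p l = real l * V_transform \<phi> (\<sigma>b\<^sup>2) + p 0 \<and> q l = \<sigma>b\<^sup>2)) \<and>
         (\<sigma>w > 0 \<longrightarrow>
            (\<lambda>l. p l / real l) \<longlonglongrightarrow> 1 \<and>
            (\<lambda>l. q l / (\<sigma>w\<^sup>2 * real l)) \<longlonglongrightarrow> 1 \<and>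
            (\<phi> = tanh \<longrightarrow>
               (\<lambda>l. p l - (real l - 2 * C * inverse \<sigma>w * sqrt (real l)
                             - C\<^sup>2 * inverse (\<sigma>w\<^sup>2) * ln (real l))) \<in> O(\<lambda>_. 1) \<and>
               (\<lambda>l. q l - (\<sigma>w\<^sup>2 * real l - 2 * C * \<sigma>w * sqrt (real l)
                             - C\<^sup>2 * ln (real l))) \<in> O(\<lambda>_. 1)))"
proof -
  have q_Suc: "q (Suc l) = \<sigma>w\<^sup>2 * p l + \<sigma>b\<^sup>2" and p_Suc: "p (Suc l) = p l + V_transform \<phi> (q (Suc l))" for l
    using assms(5) unfolding RRN_length_quantities_def by (metis add.commute diff_Suc_1 le_add1 plus_1_eq_Suc)+
  have p_nonneg: "p l \<ge> 0" for l
    by (induction l) (auto simp: assms p_Suc V_transform_nonneg)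
  have q_ge: "q l \<ge> \<sigma>b\<^sup>2" if "l \<ge> 1" for l
    using that q_Suc[of "l - 1"] p_nonneg[of "l - 1"] by simp
  hence q_pos: "q l > 0" if "l \<ge> 1" for l
    using that assms(3) by (smt (verit) zero_less_power)
  have "p l = real l * V_transform \<phi> (\<sigma>b\<^sup>2) + p 0 \<and> q l = \<sigma>b\<^sup>2" if "\<sigma>w = 0" "l \<ge> 1" for l
  proof
    show "q l = \<sigma>b\<^sup>2" using that q_Suc[of "l - 1"] by simp
    show "p l = real l * V_transform \<phi> (\<sigma>b\<^sup>2) + p 0"
      by (induction l) (auto simp: p_Suc q_Suc \<open>\<sigma>w = 0\<close> algebra_simps)
  qed
  moreover have "(\<lambda>l. p l / real l) \<longlonglongrightarrow> 1 \<and> (\<lambda>l. q l / (\<sigma>w\<^sup>2 * real l)) \<longlonglongrightarrow> 1 \<and>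
      (\<phi> = tanh \<longrightarrow>
         (\<lambda>l. p l - (real l - 2 * C * inverse \<sigma>w * sqrt (real l)
                       - C\<^sup>2 * inverse (\<sigma>w\<^sup>2) * ln (real l))) \<in> O(\<lambda>_. 1) \<and>
         (\<lambda>l. q l - (\<sigma>w\<^sup>2 * real l - 2 * C * \<sigma>w * sqrt (real l)
                       - C\<^sup>2 * ln (real l))) \<in> O(\<lambda>_. 1))" if w: "\<sigma>w > 0"
  proof -
    \<comment> \<open>All variances are at least \<open>\<sigma>b\<^sup>2\<close>, so by
      monotonicity each layer adds at least \<open>c\<close> to \<open>p\<close>. This crude linear
      bound sends \<open>q\<close> to infinity, which in turn sharpens the increments of
      \<open>p\<close> to the limit 1.\<close>
    define c where "c = V_transform \<phi> (\<sigma>b\<^sup>2)"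
    have c: "c > 0" unfolding c_def using assms by (intro V_transform_pos) auto
    have p_ge: "p l \<ge> c * real l" for l
    proof (induction l)
      case (Suc l)
      have "c \<le> V_transform \<phi> (q (Suc l))"
        unfolding c_def using assms q_ge[of "Suc l"] by (intro V_transform_mono) auto
      thus ?case using Suc by (simp add: p_Suc algebra_simps)
    qed (use assms in auto)
    have q_Suc_ge: "q (Suc l) \<ge> \<sigma>w\<^sup>2 * c * real l" for l
      using mult_left_mono[OF p_ge[of l], of "\<sigma>w\<^sup>2"] zero_le_power2[of \<sigma>b]
      unfolding q_Suc by (simp add: mult.assoc add_increasing2)
    have "filterlim (\<lambda>l. \<sigma>w\<^sup>2 * c * real l) at_top sequentially"
      using w c by (intro filterlim_tendsto_pos_mult_at_top[OF tendsto_const] filterlim_real_sequentially) auto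
    hence "filterlim (\<lambda>l. q (Suc l)) at_top sequentially"
      by (rule filterlim_at_top_mono) (simp add: q_Suc_ge)
    hence "(\<lambda>l. V_transform \<phi> (q (Suc l))) \<longlonglongrightarrow> 1"
      by (rule filterlim_compose[OF V_transform_tendsto_1[OF assms(1)]])
    hence "(\<lambda>l. p (Suc l) - p l) \<longlonglongrightarrow> 1" by (simp add: p_Suc)
    hence p_lim: "(\<lambda>l. p l / real l) \<longlonglongrightarrow> 1"
      by (rule increments_tendsto_imp_average_tendsto)
    have q_step: "q (Suc l) = q l + \<sigma>w\<^sup>2 * V_transform \<phi> (q l)" if "l \<ge> 1" for l
      using that p_Suc[of "l - 1"] q_Suc[of "l - 1"] by (simp add: q_Suc algebra_simps)
    have v01: "0 \<le> V_transform \<phi> x \<and> V_transform \<phi> x \<le> 1" if "x > 0" for x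
      using V_transform_nonneg V_transform_le_1 assms(1) that by blast
    \<comment> \<open>The shift by one is deliberate: \<open>q_step\<close> holds only from layer 1
      on, because \<open>q 0\<close> is unconstrained.\<close>
    have "(\<lambda>l. q (Suc (Suc l)) - q (Suc l)) \<longlonglongrightarrow> \<sigma>w\<^sup>2"
      using tendsto_mult[OF tendsto_const[of "\<sigma>w\<^sup>2"] \<open>(\<lambda>l. V_transform \<phi> (q (Suc l))) \<longlonglongrightarrow> 1\<close>]
      by (simp add: q_step)
    hence "(\<lambda>l. q (Suc l) - q l) \<longlonglongrightarrow> \<sigma>w\<^sup>2" by (rule LIMSEQ_imp_Suc)
    hence q_lim: "(\<lambda>l. q l / real l) \<longlonglongrightarrow> \<sigma>w\<^sup>2"
      by (rule increments_tendsto_imp_average_tendsto)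
    have q_lim': "(\<lambda>l. q l / (\<sigma>w\<^sup>2 * real l)) \<longlonglongrightarrow> 1"
      using tendsto_divide[OF q_lim tendsto_const[of "\<sigma>w\<^sup>2"]] w by (simp add: mult.commute)
    have "(\<lambda>l. p l - (real l - 2 * C * inverse \<sigma>w * sqrt (real l)
                       - C\<^sup>2 * inverse (\<sigma>w\<^sup>2) * ln (real l))) \<in> O(\<lambda>_. 1) \<and>
         (\<lambda>l. q l - (\<sigma>w\<^sup>2 * real l - 2 * C * \<sigma>w * sqrt (real l)
                       - C\<^sup>2 * ln (real l))) \<in> O(\<lambda>_. 1)" if tanh: "\<phi> = tanh"
    proof
      have C: "C \<ge> 0" using assms by simp
      obtain K where K: "K \<ge> 0"
        "\<And>x. x > 0 \<Longrightarrow> \<bar>V_transform tanh x - (1 - C / sqrt x)\<bar> \<le> K / (x * sqrt x)"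
        using V_transform_tanh_expansion unfolding assms(6) by blast
      have "Bseq (\<lambda>l. lyap C (q l) - \<sigma>w\<^sup>2 * real l)"
        using K tanh
        by (intro linear_growth_lyap_bounded[OF w C K(1) q_step v01 _ q_lim]) auto
      thus q_exp: "(\<lambda>l. q l - (\<sigma>w\<^sup>2 * real l - 2 * C * \<sigma>w * sqrt (real l)
                       - C\<^sup>2 * ln (real l))) \<in> O(\<lambda>_. 1)"
        by (rule lyap_bounded_imp_expansion[OF w C q_lim])
      have V_bdd: "(\<lambda>l. V_transform \<phi> (q l)) \<in> O(\<lambda>_. 1)"
        using v01 q_pos
        by (intro bigoI[of _ 1] eventually_mono[OF eventually_ge_at_top[of 1]]) auto
      \<comment> \<open>Equating the two expressions for \<open>q (Suc l)\<close>, by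
        \<open>q_Suc\<close> and by \<open>q_step\<close>, expresses \<open>p l\<close> as
        \<open>q l / \<sigma>w\<^sup>2\<close> plus bounded terms, so the expansion of
        \<open>q\<close> transfers.\<close>
      have "(\<lambda>l. inverse (\<sigma>w\<^sup>2) * (q l - (\<sigma>w\<^sup>2 * real l - 2 * C * \<sigma>w * sqrt (real l)
                       - C\<^sup>2 * ln (real l))) + V_transform \<phi> (q l) - \<sigma>b\<^sup>2 / \<sigma>w\<^sup>2) \<in> O(\<lambda>_. 1)"
        using q_exp V_bdd by (intro sum_in_bigo) auto
      moreover have "eventually (\<lambda>l. inverse (\<sigma>w\<^sup>2) * (q l - (\<sigma>w\<^sup>2 * real l - 2 * C * \<sigma>w * sqrt (real l)
                       - C\<^sup>2 * ln (real l))) + V_transform \<phi> (q l) - \<sigma>b\<^sup>2 / \<sigma>w\<^sup>2 =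
                   p l - (real l - 2 * C * inverse \<sigma>w * sqrt (real l)
                       - C\<^sup>2 * inverse (\<sigma>w\<^sup>2) * ln (real l))) sequentially"
        using eventually_ge_at_top[of 1]
      proof eventually_elim
        case (elim l)
        have "p l = inverse (\<sigma>w\<^sup>2) * q l + V_transform \<phi> (q l) - \<sigma>b\<^sup>2 / \<sigma>w\<^sup>2"
          using q_Suc[of l] q_step[OF elim] w by (simp add: field_simps)
        moreover have "inverse (\<sigma>w\<^sup>2) * \<sigma>w\<^sup>2 = 1" "inverse (\<sigma>w\<^sup>2) * \<sigma>w = inverse \<sigma>w"
          using w by (simp_all add: field_simps power2_eq_square)
        ultimately show ?case by algebra
      qed
      ultimately show "(\<lambda>l. p l - (real l - 2 * C * inverse \<sigma>w * sqrt (real l)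
                       - C\<^sup>2 * inverse (\<sigma>w\<^sup>2) * ln (real l))) \<in> O(\<lambda>_. 1)"
        by (rule landau_o.big.in_cong[THEN iffD1, rotated])
    qed
    thus ?thesis using p_lim q_lim' by blast
  qed
  ultimately show ?thesis by blast
qed

end
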